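(* Let $G = (V, E)$ be a hypergraph with a linear order $<$ on the edge set $E$, and let $\mathcal{B}(G, <)$ be the set of all broken cycles of $G$ with respect to $<$. Then the chromatic polynomial $\chi(G, x)$ of $G$ satisfies $$\chi(G, x) = \sum_{\substack{A \subseteq E \\ \forall B \in \mathcal{B}(G, <) \colon B \nsubseteq A}} (-1)^{|A|} x^{k(G\langle A\rangle)}.$$
   Context: A hypergraph $G = (V, E)$ is an ordered pair of a finite vertex set $V$ and a finite multiset $E$ of edges, each edge being a non-empty subset of $V$. Parallel edges are thus allowed, and edges with one vertex are allowed. Parallel copies count as distinct elements of $E$, so that subsets of $E$, their cardinalities and linear orders on $E$ refer to edge occurrences. A hypergraph $G' = (V', E')$ is a subgraph of $G$ if $V' \subseteq V$ and $E' \subseteq E$ (being a hypergraph, $G'$ has $e \subseteq V'$ for every $e \in E'$). For $A \subseteq E$, $G\langle A\rangle = (V, A)$ is the spanning subgraph with edge set $A$. $G_{-e}$ denotes the hypergraph obtained from $G$ by deleting the edge $e$ (keeping all vertices). $k(G)$ denotes the number of connected components of $G$, i.e. the number of classes of the equivalence relation on $V$ generated by relating any two vertices that lie in a common edge (so isolated vertices count as components). $G$ is $\delta$-cyclic if it has a subgraph $G' = (V', E')$ including at least one edge such that $k(G') = k(G'_{-e})$ for each edge $e \in E'$. $G$ is a $\delta$-cycle if it is $\delta$-cyclic and has no proper $\delta$-cyclic subgraph. Given a linear order $<$ on $E$, let $C = (V_C, E_C)$ be a subgraph of $G$ that is a $\delta$-cycle and let $e \in E_C$ be the maximal edge of $C$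 with respect to $<$. Then $E_C \setminus \{e\}$ is called a broken cycle in $G$ with respect to $<$. $\mathcal{B}(G, <)$ denotes the set of all broken cycles of $G$ with respect to $<$. For $k \in \mathbb{N}$, a $k$-coloring of $G$ is a function $\phi \colon V \to \{1, \ldots, k\}$. It is proper if there is no edge $e \in E$ all of whose vertices are mapped to the same element. The chromatic polynomial $\chi(G, x)$ is the polynomial whose value at each $x \in \mathbb{N}$ equals the number of proper $x$-colorings of $G$. *)

theory Defs
  imports "HOL-Library.FuncSet" "HOL-Computational_Algebra.Polynomial"
begin

text \<open>
  The multiset of edges is represented by a finite set of edge names together with a map
  \<open>ends\<close> giving the vertex set of each name. Parallel edges are distinct names with
  the same vertex set, so subsets, cardinalities and orders on \<open>edges\<close> refer to
  edge occurrences.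
\<close>

record ('v, 'e) pre_hypergraph =
  verts :: "'v set"
  edges :: "'e set"
  ends :: "'e \<Rightarrow> 'v set"

definition hypergraph :: "('v, 'e) pre_hypergraph \<Rightarrow> bool" where
  "hypergraph G \<longleftrightarrow> finite (verts G) \<and> finite (edges G) \<and>
     (\<forall>e\<in>edges G. ends G e \<noteq> {} \<and> ends G e \<subseteq> verts G)"

text \<open>
  A subgraph carries the whole map \<open>ends\<close> of its host, including the irrelevant
  values outside its own edge set; it is therefore determined by its vertex and edge sets,
  and \<open>H \<noteq> G\<close> below expresses that \<open>H\<close> is proper.
\<close>

definition subgraph :: "('v, 'e) pre_hypergraph \<Rightarrow> ('v, 'e) pre_hypergraph \<Rightarrow> bool" where
  "subgraph H G \<longleftrightarrow> hypergraph H \<and> verts H \<subseteq> verts G \<and> edges H \<subseteq> edges G \<and> ends H = ends G"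

definition spanning :: "('v, 'e) pre_hypergraph \<Rightarrow> 'e set \<Rightarrow> ('v, 'e) pre_hypergraph" where
  "spanning G A = G\<lparr>edges := A\<rparr>"

definition del_edge :: "('v, 'e) pre_hypergraph \<Rightarrow> 'e \<Rightarrow> ('v, 'e) pre_hypergraph" where
  "del_edge G e = G\<lparr>edges := edges G - {e}\<rparr>"

definition adj :: "('v, 'e) pre_hypergraph \<Rightarrow> 'v rel" where
  "adj G = {(u, v). \<exists>e\<in>edges G. u \<in> ends G e \<and> v \<in> ends G e}"

text \<open>
  Since \<open>adj G\<close> is symmetric, its reflexive transitive closure restricted to the
  vertex set is the equivalence relation on the vertices that it generates.
\<close>

definition connected_rel :: "('v, 'e) pre_hypergraph \<Rightarrow> 'v rel" where
  "connected_rel G = (adj G)\<^sup>* \<inter> verts G \<times> verts G"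

definition num_components :: "('v, 'e) pre_hypergraph \<Rightarrow> nat" where
  "num_components G = card (verts G // connected_rel G)"

definition delta_cyclic :: "('v, 'e) pre_hypergraph \<Rightarrow> bool" where
  "delta_cyclic G \<longleftrightarrow> (\<exists>H. subgraph H G \<and> edges H \<noteq> {} \<and>
     (\<forall>e\<in>edges H. num_components H = num_components (del_edge H e)))"

definition delta_cycle :: "('v, 'e) pre_hypergraph \<Rightarrow> bool" where
  "delta_cycle G \<longleftrightarrow> delta_cyclic G \<and>
     \<not> (\<exists>H. subgraph H G \<and> H \<noteq> G \<and> delta_cyclic H)"

text \<open>
  The order is given as a reflexive relation: \<open>(f, e) \<in> r\<close> means that \<open>f < e\<close> or
  \<open>f = e\<close>.
\<close>

definition broken_cycles :: "('v, 'e) pre_hypergraph \<Rightarrow> 'e rel \<Rightarrow> 'e set set" where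
  "broken_cycles G r = {edges C - {e} | C e.
     subgraph C G \<and> delta_cycle C \<and> e \<in> edges C \<and> (\<forall>f\<in>edges C. (f, e) \<in> r)}"

text \<open>
  Colorings are extensional functions, so that distinct ones differ on a vertex.
\<close>

definition colorings :: "('v, 'e) pre_hypergraph \<Rightarrow> nat \<Rightarrow> ('v \<Rightarrow> nat) set" where
  "colorings G k = verts G \<rightarrow>\<^sub>E {1..k}"

definition proper_coloring :: "('v, 'e) pre_hypergraph \<Rightarrow> ('v \<Rightarrow> nat) \<Rightarrow> bool" where
  "proper_coloring G \<phi> \<longleftrightarrow> \<not> (\<exists>e\<in>edges G. \<exists>c. \<forall>v\<in>ends G e. \<phi> v = c)"

definition chromatic_poly :: "('v, 'e) pre_hypergraph \<Rightarrow> int poly" where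
  "chromatic_poly G =
     (THE p. \<forall>x::nat. poly p (int x) = int (card {\<phi> \<in> colorings G x. proper_coloring G \<phi>}))"

end

theory Submission imports Defs begin

text \<open>
  Whitney's broken cycle argument. By inclusion-exclusion over the monochromatic edges, the
  right-hand sum taken over all \<open>A \<subseteq> E\<close> counts the proper colorings, so the sets \<open>A\<close> containing a
  broken cycle must cancel. For such an \<open>A\<close>, let \<open>e\<close> be the smallest edge completing a
  broken cycle contained in \<open>A\<close>, and toggle \<open>e\<close> in \<open>A\<close>. An edge \<open>f\<close> whose broken cycle uses \<open>e\<close>
  satisfies \<open>e < f\<close>, so \<open>e\<close> remains the smallest completing edge and the toggling is a
  sign-reversing involution. It keeps the number of components, as the broken cycle
  already connects all vertices of \<open>e\<close>.
\<close>

section \<open>Sign-reversing toggling along a finite linear order\<close>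

lemma linear_order_on_finite_least:
  assumes "finite E" and "linear_order_on E r" and "S \<subseteq> E" and "S \<noteq> {}"
  shows "\<exists>!e. e \<in> S \<and> (\<forall>f\<in>S. (e, f) \<in> r)"
proof -
  have sub: "r \<subseteq> E \<times> E" and refl: "refl_on E r" and anti: "antisym r" and tot: "total_on E r"
    using assms(2)
    by (auto simp: linear_order_on_def partial_order_on_def preorder_on_def)
  have "finite r" using sub assms(1) by (meson finite_SigmaI finite_subset)
  then have "well_order_on E r"
    using linear_order_on_well_order_on assms(2) by blast
  then have wf: "wf (r - Id)" by (simp add: well_order_on_def)
  obtain s where "s \<in> S" using assms(4) by blast
  with wf obtain e where e: "e \<in> S" "\<And>y. (y, e) \<in> r - Id \<Longrightarrow> y \<notin> S"
    by (rule wfE_min) blast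
  have "(e, f) \<in> r" if "f \<in> S" for f
  proof (cases "f = e")
    case True
    then show ?thesis using refl e(1) assms(3) by (auto simp: refl_on_def)
  next
    case False
    moreover have "f \<in> E" "e \<in> E" using that e(1) assms(3) by auto
    ultimately show ?thesis using tot e(2)[of f] that unfolding total_on_def by auto
  qed
  with e(1) show ?thesis using anti by (auto simp: antisym_def)
qed

text \<open>The cancellation, freed of hypergraphs: toggling the least completing element is an
  involution that negates \<open>w\<close>, so the sum equals its own negative, which forces 0 in an
  ordered domain.\<close>

lemma sum_broken_sets_eq_0:
  fixes w :: "'e set \<Rightarrow> 'a::linordered_idom" and P :: "('e \<times> 'e set) set"
  assumes fin: "finite E" and lin: "linear_order_on E r"
    and P: "\<And>e B. (e, B) \<in> P \<Longrightarrow> e \<in> E \<and> e \<notin> B \<and> (\<forall>b\<in>B. (b, e) \<in> r)"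
    and w: "\<And>e B A. (e, B) \<in> P \<Longrightarrow> A \<subseteq> E \<Longrightarrow> e \<notin> A \<Longrightarrow> B \<subseteq> A \<Longrightarrow> w (insert e A) = - w A"
  shows "(\<Sum>A | A \<subseteq> E \<and> (\<exists>(e, B)\<in>P. B \<subseteq> A). w A) = 0"
proof -
  define F where "F = {A. A \<subseteq> E \<and> (\<exists>(e, B)\<in>P. B \<subseteq> A)}"
  define S where "S A = {e. \<exists>B. (e, B) \<in> P \<and> B \<subseteq> A}" for A
  define m where "m A = (THE e. e \<in> S A \<and> (\<forall>f\<in>S A. (e, f) \<in> r))" for A
  define t where "t A = (if m A \<in> A then A - {m A} else insert (m A) A)" for A
  have trans: "trans r" and anti: "antisym r"
    using lin by (auto simp: linear_order_on_def partial_order_on_def preorder_on_def)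
  have SE: "S A \<subseteq> E" for A using P by (auto simp: S_def)
  have ex1: "\<exists>!e. e \<in> S A \<and> (\<forall>f\<in>S A. (e, f) \<in> r)" if "A \<in> F" for A
    using that by (intro linear_order_on_finite_least[OF fin lin SE]) (auto simp: F_def S_def)
  have m: "m A \<in> S A" "\<And>f. f \<in> S A \<Longrightarrow> (m A, f) \<in> r" if "A \<in> F" for A
    using theI'[OF ex1[OF that]] unfolding m_def by auto
  have mI: "m A = e" if "A \<in> F" "e \<in> S A" "\<And>f. f \<in> S A \<Longrightarrow> (e, f) \<in> r" for A e
    using m[OF that(1)] that(2,3) anti by (auto simp: antisym_def)
  have mE: "m A \<in> E" if "A \<in> F" for A using m(1)[OF that] SE by blast
  \<comment> \<open>A set paired with \<open>m A\<close> does not contain \<open>m A\<close>, so it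
    survives the removal.\<close>
  have S_diff: "m A \<in> S (A - {m A})" if "A \<in> F" for A
    using m(1)[OF that] P unfolding S_def by blast
  \<comment> \<open>If \<open>f\<close> completes a set only after \<open>e\<close> is inserted,
    that set contains \<open>e\<close>, so \<open>e\<close> lies below \<open>f\<close>. Hence
    inserting \<open>m A\<close> creates no smaller completing element.\<close>
  have S_insert: "f \<in> S A \<or> (e, f) \<in> r" if "f \<in> S (insert e A)" for f e A
    using that P unfolding S_def by blast
  have S_mono: "S A \<subseteq> S B" if "A \<subseteq> B" for A B
    using that unfolding S_def by blast
  have t: "t A \<in> F \<and> m (t A) = m A" if A: "A \<in> F" for A
  proof (cases "m A \<in> A")
    case True
    then have tA: "t A = A - {m A}" by (simp add: t_def)
    have "t A \<in> F" using S_diff[OF A] A unfolding tA F_def S_def by auto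
    moreover have "m (t A) = m A"
      using S_diff[OF A] m(2)[OF A] S_mono[of "t A" A] unfolding tA[symmetric]
      by (intro mI[OF \<open>t A \<in> F\<close>]) (auto simp: tA)
    ultimately show ?thesis ..
  next
    case False
    then have tA: "t A = insert (m A) A" by (simp add: t_def)
    have "t A \<in> F" using mE[OF A] A unfolding tA F_def by auto
    moreover have "m (t A) = m A"
      using m[OF A] S_mono[of A "t A"] S_insert unfolding tA
      by (intro mI[OF \<open>t A \<in> F\<close>[unfolded tA]]) blast+
    ultimately show ?thesis ..
  qed
  have tt: "t (t A) = A" if "A \<in> F" for A
    using t[OF that] unfolding t_def by (auto split: if_splits)
  have wt: "w (t A) = - w A" if A: "A \<in> F" for A
  proof -
    have AE: "A \<subseteq> E" using A by (simp add: F_def)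
    \<comment> \<open>With \<open>B\<close> inside \<open>A - {m A}\<close>, the hypothesis on
      \<open>w\<close> applies to \<open>A - {m A}\<close> whether or not \<open>m A\<close> belongs
      to \<open>A\<close>.\<close>
    obtain B where B: "(m A, B) \<in> P" "B \<subseteq> A - {m A}"
      using S_diff[OF A] by (auto simp: S_def)
    then have "w (insert (m A) (A - {m A})) = - w (A - {m A})"
      using AE by (intro w[OF B(1)]) auto
    then show ?thesis by (auto simp: t_def insert_absorb)
  qed
  have "sum w F = (\<Sum>A\<in>F. w (t A))"
    by (rule sum.reindex_bij_witness[of _ t t]) (use t tt in auto)
  also have "\<dots> = - sum w F" by (simp add: wt sum_negf)
  finally show ?thesis unfolding F_def by simp
qed

section \<open>Alternating sums, equivalence classes and equality of polynomials\<close>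

lemma sum_Pow_minus_one_power_card:
  assumes "finite F"
  shows "(\<Sum>A\<in>Pow F. (- 1) ^ card A) = (if F = {} then 1 else 0 :: 'a::comm_ring_1)"
  \<comment> \<open>The alternating sum is the expanded product of \<open>1 - 1\<close> over
    \<open>F\<close>; only the empty product avoids a factor 0.\<close>
  using prod_diff_conv_sum[of F "\<lambda>_. 1 :: 'a" "\<lambda>_. 1"] assms
  by (cases "F = {}") (simp_all add: power_0_left)

text \<open>Sending an \<open>R\<close>-class to the \<open>S\<close>-class containing it is onto;
  between finite quotients of equal size it is also injective, so no two \<open>R\<close>-classes
  merge. This turns equal component counts into equal connectivity.\<close>

lemma refines_card_quotient_eq:
  assumes "finite V" and R: "equiv V R" and S: "equiv V S" and RS: "R \<subseteq> S"
    and card: "card (V // R) = card (V // S)"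
  shows "R = S"
proof
  have img: "(\<lambda>X. S `` X) ` (V // R) = V // S"
    using refines_equiv_image_eq[OF RS R S] .
  have "finite (V // R)" using assms(1) R by (simp add: finite_quotient equiv_type)
  then have inj: "inj_on (\<lambda>X. S `` X) (V // R)"
    using img card by (intro eq_card_imp_inj_on) auto
  show "S \<subseteq> R"
  proof (rule subrelI)
    fix x y assume xy: "(x, y) \<in> S"
    then have V: "x \<in> V" "y \<in> V" using equiv_type[OF S] by auto
    have "S `` (R `` {x}) = S `` (R `` {y})"
      using refines_equiv_class_eq2[OF RS R S] equiv_class_eq[OF S xy] by simp
    then have "R `` {x} = R `` {y}"
      by (rule inj_onD[OF inj]) (simp_all add: V quotientI)
    then show "(x, y) \<in> R" using eq_equiv_class[OF _ R V(2)] by blast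
  qed
qed (fact RS)

text \<open>Such functions correspond to functions on the classes: \<open>?f\<close> pulls back
  along the quotient map, \<open>?h\<close> evaluates at a chosen representative. The restrictions
  make them inverse on extensional functions.\<close>

lemma card_funs_respecting_equiv:
  assumes "finite V" and R: "equiv V R"
  shows "card {\<phi> \<in> V \<rightarrow>\<^sub>E T. \<forall>(u, v)\<in>R. \<phi> u = \<phi> v} = card T ^ card (V // R)"
proof -
  let ?K = "{\<phi> \<in> V \<rightarrow>\<^sub>E T. \<forall>(u, v)\<in>R. \<phi> u = \<phi> v}"
  let ?f = "\<lambda>g. restrict (\<lambda>v. g (R `` {v})) V"
  let ?h = "\<lambda>\<phi>. restrict (\<lambda>X. \<phi> (SOME v. v \<in> X)) (V // R)"
  have some: "(SOME v. v \<in> X) \<in> X" if "X \<in> V // R" for X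
    using in_quotient_imp_non_empty[OF R that] by (simp add: some_in_eq)
  have sub: "X \<subseteq> V" if "X \<in> V // R" for X
    using in_quotient_imp_subset[OF R that] .
  have cls: "R `` {v} = X" if "X \<in> V // R" "v \<in> X" for X v
    using that R by (metis Image_singleton_iff equiv_class_eq quotientE)
  have "bij_betw ?f ((V // R) \<rightarrow>\<^sub>E T) ?K"
  proof (rule bij_betw_byWitness[where f' = ?h])
    show "\<forall>g\<in>(V // R) \<rightarrow>\<^sub>E T. ?h (?f g) = g"
    proof (intro ballI ext)
      fix g X assume g: "g \<in> (V // R) \<rightarrow>\<^sub>E T"
      show "?h (?f g) X = g X"
      proof (cases "X \<in> V // R")
        case True
        then show ?thesis using some[OF True] sub[OF True] cls[OF True] by auto
      next
        case False
        then show ?thesis using g by (auto simp: PiE_def extensional_def)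
      qed
    qed
    show "\<forall>\<phi>\<in>?K. ?f (?h \<phi>) = \<phi>"
    proof (intro ballI ext)
      fix \<phi> v assume \<phi>: "\<phi> \<in> ?K"
      show "?f (?h \<phi>) v = \<phi> v"
      proof (cases "v \<in> V")
        case True
        then have X: "R `` {v} \<in> V // R" by (rule quotientI)
        have "(v, SOME u. u \<in> R `` {v}) \<in> R" using some[OF X] by simp
        then have "\<phi> v = \<phi> (SOME u. u \<in> R `` {v})" using \<phi> by blast
        then show ?thesis using True X by simp
      next
        case False
        then show ?thesis using \<phi> by (auto simp: PiE_def extensional_def)
      qed
    qed
    show "?f ` ((V // R) \<rightarrow>\<^sub>E T) \<subseteq> ?K"
    proof
      fix \<phi> assume "\<phi> \<in> ?f ` ((V // R) \<rightarrow>\<^sub>E T)"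
      then obtain g where g: "g \<in> (V // R) \<rightarrow>\<^sub>E T" and \<phi>: "\<phi> = ?f g" by blast
      have "\<phi> \<in> V \<rightarrow>\<^sub>E T" using g unfolding \<phi> by (auto intro!: quotientI)
      moreover have "\<phi> u = \<phi> v" if "(u, v) \<in> R" for u v
        using equiv_class_eq[OF R that] equiv_type[OF R] that unfolding \<phi> by auto
      ultimately show "\<phi> \<in> ?K" by auto
    qed
    show "?h ` ?K \<subseteq> (V // R) \<rightarrow>\<^sub>E T"
      using some sub by (fastforce intro!: restrict_PiE_iff[THEN iffD2])
  qed
  then have "card ?K = card ((V // R) \<rightarrow>\<^sub>E T)" by (simp add: bij_betw_same_card)
  then show ?thesis
    using assms by (simp add: card_funcsetE finite_quotient equiv_type)
qed

text \<open>A nonzero \<open>p - q\<close> would have every natural number as a root. This makes the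
  chromatic polynomial unique.\<close>

lemma poly_int_eqI:
  fixes p q :: "int poly"
  assumes "\<And>n::nat. poly p (int n) = poly q (int n)"
  shows "p = q"
proof (rule ccontr)
  assume "p \<noteq> q"
  then have "finite {x. poly (p - q) x = 0}" by (intro poly_roots_finite) simp
  moreover have "range int \<subseteq> {x. poly (p - q) x = 0}" using assms by auto
  ultimately show False
    using finite_subset range_inj_infinite[OF inj_of_nat] by blast
qed

section \<open>Components and delta-cycles\<close>

lemma equiv_connected_rel: "equiv (verts G) (connected_rel G)"
proof (rule equivI)
  have "sym ((adj G)\<^sup>*)" by (rule sym_rtrancl) (auto simp: adj_def sym_def)
  then show "sym (connected_rel G)" by (auto simp: connected_rel_def sym_def)
  show "trans (connected_rel G)"
    by (auto simp: connected_rel_def trans_def)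
qed (auto simp: connected_rel_def refl_on_def)

lemma connected_relI:
  "hypergraph G \<Longrightarrow> e \<in> edges G \<Longrightarrow> u \<in> ends G e \<Longrightarrow> v \<in> ends G e \<Longrightarrow> (u, v) \<in> connected_rel G"
  by (auto simp: connected_rel_def adj_def hypergraph_def intro!: r_into_rtrancl)

text \<open>A subgraph \<open>H\<close> witnessing that \<open>C\<close> is delta-cyclic is itself
  delta-cyclic, so minimality of \<open>C\<close> forces \<open>H = C\<close>.\<close>

lemma delta_cycle_num_components:
  assumes "delta_cycle C" and "e \<in> edges C"
  shows "num_components C = num_components (del_edge C e)"
proof -
  obtain H where H: "subgraph H C" "edges H \<noteq> {}"
      "\<forall>e\<in>edges H. num_components H = num_components (del_edge H e)"
    using assms(1) by (auto simp: delta_cycle_def delta_cyclic_def)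
  have "subgraph H H" using H(1) by (simp add: subgraph_def)
  then have "delta_cyclic H" using H by (auto simp: delta_cyclic_def)
  then have "H = C" using assms(1) H(1) by (auto simp: delta_cycle_def)
  then show ?thesis using H(3) assms(2) by blast
qed

text \<open>Deleting \<open>e\<close> keeps the component count, and a finer connectivity relation
  with equally many classes is the same relation. So the rest of the cycle still joins the vertices
  of \<open>e\<close>.\<close>

lemma delta_cycle_ends_connected:
  assumes C: "hypergraph C" "delta_cycle C" and e: "e \<in> edges C"
  shows "ends C e \<times> ends C e \<subseteq> (adj (del_edge C e))\<^sup>*"
proof -
  have V: "verts (del_edge C e) = verts C" by (simp add: del_edge_def)
  have "adj (del_edge C e) \<subseteq> adj C" by (auto simp: adj_def del_edge_def)
  then have sub: "connected_rel (del_edge C e) \<subseteq> connected_rel C"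
    unfolding connected_rel_def V using rtrancl_mono by blast
  have "connected_rel (del_edge C e) = connected_rel C"
  proof (rule refines_card_quotient_eq)
    show "finite (verts C)" using C(1) by (simp add: hypergraph_def)
    show "equiv (verts C) (connected_rel (del_edge C e))"
      using equiv_connected_rel[of "del_edge C e"] by (simp add: V)
    show "card (verts C // connected_rel (del_edge C e)) = card (verts C // connected_rel C)"
      using delta_cycle_num_components[OF C(2) e] by (simp add: num_components_def V)
  qed (fact equiv_connected_rel sub)+
  then show ?thesis
    using connected_relI[OF C(1) e] by (auto simp: connected_rel_def)
qed

text \<open>The pairs added by \<open>e\<close> already lie in the closure, so the components do not
  change.\<close>

lemma num_components_spanning_insert:
  assumes "ends G e \<times> ends G e \<subseteq> (adj (spanning G A))\<^sup>*"
  shows "num_components (spanning G (insert e A)) = num_components (spanning G A)"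
proof -
  have "adj (spanning G (insert e A)) = adj (spanning G A) \<union> ends G e \<times> ends G e"
    by (auto simp: adj_def spanning_def)
  then have "(adj (spanning G (insert e A)))\<^sup>* = (adj (spanning G A))\<^sup>*"
    using assms by (intro rtrancl_subset) auto
  then show ?thesis
    by (simp add: num_components_def connected_rel_def) (simp add: spanning_def)
qed

section \<open>Monochromatic edges and inclusion-exclusion\<close>

definition mono_edges :: "('v, 'e) pre_hypergraph \<Rightarrow> ('v \<Rightarrow> nat) \<Rightarrow> 'e set" where
  "mono_edges G \<phi> = {e \<in> edges G. \<exists>c. \<forall>v\<in>ends G e. \<phi> v = c}"

text \<open>A color spreads along walks through monochromatic edges; conversely, the vertices of an
  edge in \<open>A\<close> lie in one component.\<close>

lemma subset_mono_edges_iff: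
  assumes "hypergraph G" and "A \<subseteq> edges G"
  shows "A \<subseteq> mono_edges G \<phi> \<longleftrightarrow> (\<forall>(u, v)\<in>connected_rel (spanning G A). \<phi> u = \<phi> v)"
proof
  assume A: "A \<subseteq> mono_edges G \<phi>"
  have "\<phi> u = \<phi> v" if "(u, v) \<in> (adj (spanning G A))\<^sup>*" for u v
    using that
  proof induction
    case (step v w)
    then obtain e where "e \<in> A" "v \<in> ends G e" "w \<in> ends G e"
      by (auto simp: adj_def spanning_def)
    then have "\<phi> v = \<phi> w" using A by (auto simp: mono_edges_def)
    with step show ?case by simp
  qed simp
  then show "\<forall>(u, v)\<in>connected_rel (spanning G A). \<phi> u = \<phi> v"
    by (auto simp: connected_rel_def)
next
  assume const: "\<forall>(u, v)\<in>connected_rel (spanning G A). \<phi> u = \<phi> v"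
  have "hypergraph (spanning G A)"
    using assms by (auto simp: hypergraph_def spanning_def intro: finite_subset)
  then have "\<phi> u = \<phi> v" if "e \<in> A" "u \<in> ends G e" "v \<in> ends G e" for e u v
    using const connected_relI[of "spanning G A" e u v] that by (auto simp: spanning_def)
  then show "A \<subseteq> mono_edges G \<phi>"
    using assms(2) unfolding mono_edges_def by blast
qed

text \<open>Making all edges of \<open>A\<close> monochromatic leaves a free choice of one color per
  component.\<close>

lemma card_colorings_mono:
  assumes "hypergraph G" and "A \<subseteq> edges G"
  shows "card {\<phi> \<in> colorings G k. A \<subseteq> mono_edges G \<phi>} = k ^ num_components (spanning G A)"
proof -
  have V: "verts (spanning G A) = verts G" by (simp add: spanning_def)
  have "{\<phi> \<in> colorings G k. A \<subseteq> mono_edges G \<phi>} =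
    {\<phi> \<in> verts G \<rightarrow>\<^sub>E {1..k}. \<forall>(u, v)\<in>connected_rel (spanning G A). \<phi> u = \<phi> v}"
    by (simp add: subset_mono_edges_iff[OF assms] colorings_def)
  then show ?thesis
    using card_funs_respecting_equiv[of "verts G" "connected_rel (spanning G A)" "{1..k}"]
      equiv_connected_rel[of "spanning G A"] assms(1)
    by (simp add: V num_components_def hypergraph_def)
qed

text \<open>Double counting: the power of \<open>k\<close> counts the colorings that make all of
  \<open>A\<close> monochromatic. After exchanging the sums, each coloring contributes the
  alternating sum over the subsets of its monochromatic edges.\<close>

lemma card_proper_colorings:
  assumes "hypergraph G"
  shows "int (card {\<phi> \<in> colorings G k. proper_coloring G \<phi>}) =
    (\<Sum>A\<in>Pow (edges G). (- 1) ^ card A * int k ^ num_components (spanning G A))"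
proof -
  have E: "finite (edges G)" and K: "finite (colorings G k)"
    using assms by (auto simp: hypergraph_def colorings_def intro: finite_PiE)
  have proper: "proper_coloring G \<phi> \<longleftrightarrow> mono_edges G \<phi> = {}" for \<phi>
    by (auto simp: proper_coloring_def mono_edges_def)
  have "(\<Sum>A\<in>Pow (edges G). (- 1) ^ card A * int k ^ num_components (spanning G A)) =
    (\<Sum>A\<in>Pow (edges G). \<Sum>\<phi>\<in>colorings G k. if A \<subseteq> mono_edges G \<phi> then (- 1) ^ card A else 0)"
  proof (rule sum.cong)
    fix A assume "A \<in> Pow (edges G)"
    then have "int k ^ num_components (spanning G A) =
        int (card {\<phi> \<in> colorings G k. A \<subseteq> mono_edges G \<phi>})"
      using card_colorings_mono[OF assms, of A k] by simp
    then show "(- 1) ^ card A * int k ^ num_components (spanning G A) =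
        (\<Sum>\<phi>\<in>colorings G k. if A \<subseteq> mono_edges G \<phi> then (- 1) ^ card A else 0)"
      using K by (simp add: sum.inter_filter[symmetric])
  qed simp
  also have "\<dots> = (\<Sum>\<phi>\<in>colorings G k. \<Sum>A\<in>Pow (edges G).
      if A \<subseteq> mono_edges G \<phi> then (- 1) ^ card A else 0)"
    by (rule sum.swap)
  \<comment> \<open>The inner alternating sum is 1 if no edge is monochromatic and 0
    otherwise.\<close>
  also have "\<dots> = (\<Sum>\<phi>\<in>colorings G k. if proper_coloring G \<phi> then 1 else 0)"
  proof (rule sum.cong)
    fix \<phi>
    have "{A \<in> Pow (edges G). A \<subseteq> mono_edges G \<phi>} = Pow (mono_edges G \<phi>)"
      by (auto simp: mono_edges_def)
    moreover have "finite (mono_edges G \<phi>)" using E by (simp add: mono_edges_def)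
    ultimately show "(\<Sum>A\<in>Pow (edges G). if A \<subseteq> mono_edges G \<phi> then (- 1) ^ card A else 0) =
        (if proper_coloring G \<phi> then 1 else 0 :: int)"
      using E by (simp add: sum.inter_filter[symmetric] sum_Pow_minus_one_power_card proper)
  qed simp
  also have "\<dots> = int (card {\<phi> \<in> colorings G k. proper_coloring G \<phi>})"
    using K by (simp add: sum.inter_filter[symmetric])
  finally show ?thesis ..
qed

text \<open>The expansion is a polynomial with the required values, and agreement at all naturals
  leaves no other candidate for the definite description.\<close>

lemma chromatic_poly_eq_sum_Pow:
  assumes "hypergraph G"
  shows "chromatic_poly G =
    (\<Sum>A\<in>Pow (edges G). monom ((- 1) ^ card A) (num_components (spanning G A)))"
  unfolding chromatic_poly_def
proof (rule the_equality)
  show *: "\<forall>x. poly (\<Sum>A\<in>Pow (edges G). monom ((- 1) ^ card A) (num_components (spanning G A))) (int x) =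
    int (card {\<phi> \<in> colorings G x. proper_coloring G \<phi>})"
    by (simp add: card_proper_colorings[OF assms] poly_sum poly_monom)
  fix p assume "\<forall>x. poly p (int x) = int (card {\<phi> \<in> colorings G x. proper_coloring G \<phi>})"
  with * show "p = (\<Sum>A\<in>Pow (edges G). monom ((- 1) ^ card A) (num_components (spanning G A)))"
    by (intro poly_int_eqI) simp
qed

section \<open>Cancellation of the edge sets containing a broken cycle\<close>

theorem theorem9:
  fixes G :: "('v, 'e) pre_hypergraph" and r :: "'e rel"
  assumes "hypergraph G" and "linear_order_on (edges G) r"
  shows "chromatic_poly G =
    (\<Sum>A | A \<subseteq> edges G \<and> (\<forall>B\<in>broken_cycles G r. \<not> B \<subseteq> A).
       monom ((- 1) ^ card A) (num_components (spanning G A)))"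
proof -
  let ?w = "\<lambda>A. monom ((- 1) ^ card A) (num_components (spanning G A)) :: int poly"
  let ?good = "{A. A \<subseteq> edges G \<and> (\<forall>B\<in>broken_cycles G r. \<not> B \<subseteq> A)}"
  \<comment> \<open>The removed edge is stored beside its broken cycle, since several edges may
    complete the same set, for example parallel copies.\<close>
  define P where "P = {(e, edges C - {e}) | C e.
     subgraph C G \<and> delta_cycle C \<and> e \<in> edges C \<and> (\<forall>f\<in>edges C. (f, e) \<in> r)}"
  let ?bad = "{A. A \<subseteq> edges G \<and> (\<exists>(e, B)\<in>P. B \<subseteq> A)}"
  have fin: "finite (edges G)" using assms(1) by (simp add: hypergraph_def)
  have B: "B \<in> broken_cycles G r \<longleftrightarrow> (\<exists>e. (e, B) \<in> P)" for B
    by (auto simp: broken_cycles_def P_def)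
  have "(\<exists>(e, B)\<in>P. B \<subseteq> A) \<longleftrightarrow> (\<exists>B. (\<exists>e. (e, B) \<in> P) \<and> B \<subseteq> A)" for A
    by (simp add: Bex_def) blast
  then have bad: "?bad = {A. A \<subseteq> edges G \<and> \<not> (\<forall>B\<in>broken_cycles G r. \<not> B \<subseteq> A)}"
    by (simp add: B[symmetric] Bex_def)
  have split: "Pow (edges G) = ?good \<union> ?bad" "?good \<inter> ?bad = {}"
    unfolding bad by blast+
  have "sum ?w ?bad = 0"
  proof (rule sum_broken_sets_eq_0[OF fin assms(2)])
    show "e \<in> edges G \<and> e \<notin> B \<and> (\<forall>b\<in>B. (b, e) \<in> r)" if "(e, B) \<in> P" for e B
      using that by (auto simp: P_def subgraph_def)
    show "?w (insert e A) = - ?w A"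
      if P: "(e, B) \<in> P" and A: "A \<subseteq> edges G" "e \<notin> A" and B: "B \<subseteq> A" for e B A
    proof -
      obtain C where C: "subgraph C G" "delta_cycle C" "e \<in> edges C" "B = edges C - {e}"
        using P by (auto simp: P_def)
      have "hypergraph C" and ends: "ends C = ends G" using C(1) by (auto simp: subgraph_def)
      then have "ends G e \<times> ends G e \<subseteq> (adj (del_edge C e))\<^sup>*"
        using delta_cycle_ends_connected[OF _ C(2,3)] by simp
      \<comment> \<open>All edges of \<open>C\<close> other than \<open>e\<close> lie in
        \<open>A\<close>, so walks in \<open>C\<close> avoiding \<open>e\<close> are available in
        the spanning subgraph.\<close>
      also have "adj (del_edge C e) \<subseteq> adj (spanning G A)"
        using B C(4) by (auto simp: adj_def del_edge_def spanning_def ends)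
      then have "(adj (del_edge C e))\<^sup>* \<subseteq> (adj (spanning G A))\<^sup>*" by (rule rtrancl_mono)
      finally have "num_components (spanning G (insert e A)) = num_components (spanning G A)"
        by (rule num_components_spanning_insert)
      moreover have "finite A" using A(1) fin by (rule finite_subset)
      \<comment> \<open>The exponent stays while the cardinality grows by one, so only the sign
        changes.\<close>
      ultimately show ?thesis using A(2) by (simp add: minus_monom)
    qed
  qed
  moreover have "sum ?w (Pow (edges G)) = sum ?w ?good + sum ?w ?bad"
    unfolding split(1) using fin split(2) by (intro sum.union_disjoint) auto
  ultimately show ?thesis
    using chromatic_poly_eq_sum_Pow[OF assms(1)] by simp
qed

end
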